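(* Fix a real number $r\ge1$, let $G=(V,E)$ be a finite simple graph with fractionally $r$-colorable neighborhoods, and let $\lambda\in\mathbb R_{>0}^V$. Write $\ell_v=\log(1+\lambda_v)$. Then $$\log Z_G(\lambda)\ge\sup_{w\in\mathbb R_{>0}^V}\left\{\sum_{v\in V}w(v)\left(1+\log\frac{\ell_v}{w(v)}\right)-K(r)\sum_{uv\in E}w(u)w(v)\right\}.$$ Consequently, $$\log Z_G(\lambda)\ge\sum_{v\in V}\frac{\mathcal A\bigl(W(K(r)d(v)\ell_v)\bigr)}{K(r)d(v)},$$ where the summand for $d(v)=0$ is interpreted as $\ell_v$.
   Context: All graphs are finite and simple; $\log$ is the natural logarithm. $N(v)$ is the set of neighbors of $v$ and $d(v)=|N(v)|$. $\mathcal I(G)$ is the set of independent sets of $G$ including $\emptyset$; the multivariate independence polynomial is $Z_G(\lambda)=\sum_{I\in\mathcal I(G)}\prod_{v\in I}\lambda_v$. The neighborhoods of $G$ are fractionally $r$-colorable if for each $v\in V$ there is a probability distribution on $\mathcal I(G[N(v)])$ under which every vertex of $N(v)$ belongs to the random independent set with probability exactly $1/r$. For $r\ge1$, $K(r)$ is the unique $K\ge1$ satisfying $K-1=\log(rK)$. $\mathcal A(x)=x^2/2+x$. $W$ is the principal nonnegative branch of the Lambert function: for $z\ge0$, $W(z)\ge0$ and $W(z)e^{W(z)}=z$. *)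

theory Defs
  imports "HOL-Probability.Probability"
begin

text \<open>A graph is a vertex set together with a set of two-element vertex sets.\<close>

locale finite_simple_graph =
  fixes V :: "'a set" and E :: "'a set set"
  assumes finite_vertices: "finite V"
    and edges: "\<And>e. e \<in> E \<Longrightarrow> e \<subseteq> V \<and> card e = 2"

definition neighborhood :: "'a set set \<Rightarrow> 'a \<Rightarrow> 'a set" where
  "neighborhood E v = {u. {u, v} \<in> E}"

definition vertex_degree :: "'a set set \<Rightarrow> 'a \<Rightarrow> nat" where
  "vertex_degree E v = card (neighborhood E v)"

definition induced_edges :: "'a set set \<Rightarrow> 'a set \<Rightarrow> 'a set set" where
  "induced_edges E U = {e \<in> E. e \<subseteq> U}"

definition indep_sets :: "'a set \<Rightarrow> 'a set set \<Rightarrow> 'a set set" where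
  "indep_sets V E = {I. I \<subseteq> V \<and> (\<forall>u\<in>I. \<forall>v\<in>I. {u, v} \<notin> E)}"

definition indep_poly :: "'a set \<Rightarrow> 'a set set \<Rightarrow> ('a \<Rightarrow> real) \<Rightarrow> real" where
  "indep_poly V E lam = (\<Sum>I\<in>indep_sets V E. \<Prod>v\<in>I. lam v)"

definition fractionally_colorable_neighborhoods ::
    "real \<Rightarrow> 'a set \<Rightarrow> 'a set set \<Rightarrow> bool" where
  "fractionally_colorable_neighborhoods r V E \<longleftrightarrow>
     (\<forall>v\<in>V. \<exists>p :: 'a set pmf.
        set_pmf p \<subseteq> indep_sets (neighborhood E v) (induced_edges E (neighborhood E v)) \<and>
        (\<forall>u\<in>neighborhood E v. measure_pmf.prob p {I. u \<in> I} = 1 / r))"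

text \<open>The two description operators below are justified by the uniqueness lemmas
  \<open>K_const_ex1\<close> (for \<open>r \<ge> 1\<close>) and \<open>Lambert_W_ex1\<close> (for \<open>z \<ge> 0\<close>).\<close>

definition K_const :: "real \<Rightarrow> real" where
  "K_const r = (THE K. K \<ge> 1 \<and> K - 1 = ln (r * K))"

definition Lambert_W :: "real \<Rightarrow> real" where
  "Lambert_W z = (THE w. w \<ge> 0 \<and> w * exp w = z)"

definition A_fun :: "real \<Rightarrow> real" where
  "A_fun x = x\<^sup>2 / 2 + x"

lemma K_const_ex1:
  fixes r :: real
  assumes "r \<ge> 1"
  shows "\<exists>!K. K \<ge> 1 \<and> K - 1 = ln (r * K)"
proof -
  define f where "f = (\<lambda>K::real. K - 1 - ln (r * K))"
  define M where "M = 2 + 2 * ln r"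
  have lnr: "ln r \<ge> 0" using assms by simp
  have M: "M \<ge> 2" using lnr by (simp add: M_def)
  have "ln (M / 2) \<le> M / 2 - 1" using M by (intro ln_le_minus_one) auto
  moreover have "ln (M / 2) = ln M - ln 2" using M by (simp add: ln_div)
  moreover have "ln (r * M) = ln r + ln M" using assms M by (simp add: ln_mult)
  moreover have "ln 2 \<le> (2::real) - 1" by (rule ln_le_minus_one) simp
  moreover have "M / 2 - 1 = ln r" by (simp add: M_def field_simps)
  ultimately have fM: "f M \<ge> 0" by (simp add: f_def)
  have f1: "f 1 \<le> 0" using lnr by (simp add: f_def)
  have "continuous_on {1..M} f"
    unfolding f_def using assms by (intro continuous_intros) auto
  then obtain K where K: "1 \<le> K" "f K = 0"
    using IVT'[of f 1 0 M] f1 fM M by auto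
  have less: "f x < f y" if "1 \<le> x" "x < y" for x y
  proof -
    have "ln (y / x) < y / x - 1"
    proof -
      have "ln (y / x) \<le> y / x - 1" using that by (intro ln_le_minus_one) auto
      moreover have "ln (y / x) \<noteq> y / x - 1"
        using ln_eq_minus_one[of "y / x"] that by (auto simp: field_simps)
      ultimately show ?thesis by linarith
    qed
    also have "y / x - 1 = (y - x) / x" using that by (simp add: field_simps)
    also have "\<dots> \<le> (y - x) / 1" using that by (intro divide_left_mono) auto
    finally have "ln (y / x) < y - x" by simp
    moreover have "ln (y / x) = ln y - ln x" using that by (simp add: ln_div)
    moreover have "ln (r * x) = ln r + ln x" "ln (r * y) = ln r + ln y"
      using assms that by (auto simp: ln_mult)
    ultimately show ?thesis by (simp add: f_def)
  qed
  show ?thesis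
  proof (rule ex1I[of _ K])
    show "K \<ge> 1 \<and> K - 1 = ln (r * K)" using K by (simp add: f_def)
  next
    fix L assume "L \<ge> 1 \<and> L - 1 = ln (r * L)"
    then have "L \<ge> 1" "f L = 0" by (auto simp: f_def)
    then show "L = K" using less[of L K] less[of K L] K by (cases L K rule: linorder_cases) auto
  qed
qed

lemma Lambert_W_ex1:
  fixes z :: real
  assumes "z \<ge> 0"
  shows "\<exists>!w. w \<ge> 0 \<and> w * exp w = z"
proof -
  have "z * 1 \<le> z * exp z" using assms by (intro mult_left_mono) auto
  moreover have "continuous_on {0..z} (\<lambda>w. w * exp w)" by (intro continuous_intros)
  ultimately obtain w where w: "0 \<le> w" "w * exp w = z"
    using IVT'[of "\<lambda>w. w * exp w" 0 z z] assms by auto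
  have less: "x * exp x < y * exp y" if "0 \<le> x" "x < y" for x y :: real
    using that by (intro mult_strict_mono) auto
  show ?thesis
  proof (rule ex1I[of _ w])
    show "w \<ge> 0 \<and> w * exp w = z" using w by simp
  next
    fix x assume "x \<ge> 0 \<and> x * exp x = z"
    then show "x = w" using less[of x w] less[of w x] w by (cases x w rule: linorder_cases) auto
  qed
qed

end

theory Submission
  imports Defs "HOL-Real_Asymp.Real_Asymp"
begin

text \<open>
  Put \<open>F(l, w) = (\<Sum>v. w v (1 + ln (l v / w v))) - K (\<Sum>uv\<in>E. w u w v)\<close> with \<open>K \<ge> 1 + ln r\<close>; the
  constant of the theorem satisfies this, since \<open>K - 1 = ln r + ln K\<close> and \<open>K \<ge> 1\<close>. The claim is
  \<open>ln Z \<ge> F(l, w)\<close> at the fugacities \<open>exp (l v) - 1\<close>. In these coordinates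
  \<open>Z\<close> has the partial derivative \<open>exp (l v) Z(G - N[v])\<close> in the direction of \<open>l v\<close>,
  so \<open>Z\<close> can be bounded by integrating along the ray \<open>t l\<close>, with a bound for smaller graphs
  supplied by induction.

  The integrand is controlled at a maximiser \<open>w\<close> of \<open>F(l, _)\<close>. There
  \<open>w v = l v exp (- K w(N(v)))\<close>, so that a rate of growth
  \<open>l v exp (F(l, w) - K w(N(v)))\<close> is just what makes \<open>Z\<close> keep up with \<open>exp F\<close>. By the
  induction hypothesis it suffices that \<open>F\<close> drops by at most \<open>K w(N(v))\<close> when \<open>N(v)\<close> is deleted.
  By stationarity, the drop is exactly \<open>w(N(v)) + K e(N(v))\<close>, where \<open>e(S)\<close> is the
  \<open>w\<close>-weight of the edges inside \<open>S\<close> (\<open>functional_delete_closed_neighborhood\<close>).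

  Colorability bounds \<open>e(N(v))\<close>. Draw an independent set \<open>J\<close> from the given distribution on
  \<open>N(v)\<close> and replace \<open>w\<close> on \<open>N(v)\<close> by \<open>r w\<close> on \<open>J\<close> and \<open>0\<close> elsewhere. On average all terms
  linear in \<open>w\<close> on \<open>N(v)\<close> are preserved, the edges inside \<open>N(v)\<close> are gained, and the entropy
  loses \<open>w(N(v)) ln r\<close>. As \<open>w\<close> is a maximiser, \<open>K e(N(v)) \<le> w(N(v)) ln r\<close>
  (\<open>neighborhood_edge_weight_le\<close>), and \<open>1 + ln r \<le> K\<close> finishes the estimate.

  Integration along the ray takes the form of a minimum principle
  (\<open>ln_indep_poly_ge_functional\<close>): if \<open>ln Z(t l) - F(t l, t x)\<close> were somewhere negative, its minimum
  over \<open>t \<in> [0, 1]\<close> and a compact box of vectors \<open>x\<close> would be attained at some \<open>t > 0\<close> with \<open>t x\<close> a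
  maximiser, but its derivative in \<open>t\<close> is positive there.

  The explicit bound comes from the test weights \<open>w v = W(K d(v) l v) / (K d(v))\<close>, which are the exact
  optimum once \<open>w u w v\<close> is estimated by \<open>(w u\<^sup>2 + w v\<^sup>2) / 2\<close> on every edge.
\<close>

section \<open>The entropy term\<close>

text \<open>At \<open>w = 0\<close> the conventions for division by zero and \<open>ln 0\<close> give the value \<open>0\<close>, which is the
  continuous extension; zero weights may therefore take part in the maximisation.\<close>

definition ent :: "real \<Rightarrow> real \<Rightarrow> real" where
  "ent l w = w * (1 + ln (l / w))"

lemma ent_le:
  assumes "l > 0" "w \<ge> 0"
  shows "ent l w \<le> l"
proof (cases "w = 0")
  case False
  then have "w * (1 + ln (l / w)) \<le> w * (l / w)"
    using assms ln_le_minus_one[of "l / w"] by (intro mult_left_mono) auto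
  then show ?thesis using False by (simp add: ent_def)
qed (use assms in \<open>simp add: ent_def\<close>)

lemma ent_eq_iff:
  assumes "l > 0" "w \<ge> 0"
  shows "ent l w = l \<longleftrightarrow> w = l"
proof (cases "w = 0")
  case False
  have "ent l w = l \<longleftrightarrow> ln (l / w) = l / w - 1"
    using False by (auto simp: ent_def field_simps)
  also have "\<dots> \<longleftrightarrow> w = l"
    using ln_eq_minus_one[of "l / w"] False assms by (auto simp: field_simps)
  finally show ?thesis .
qed (use assms in \<open>auto simp: ent_def\<close>)

lemma ent_scale: "t \<ge> 0 \<Longrightarrow> ent (t * l) (t * w) = t * ent l w"
  by (cases "t = 0") (simp_all add: ent_def)

text \<open>A linear term in \<open>w\<close> is a change of \<open>l\<close>. Together with \<open>ent_le\<close> and \<open>ent_eq_iff\<close> this solves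
  every one-coordinate maximisation below without differentiating.\<close>

lemma ent_exp:
  assumes "l > 0" "w \<ge> 0"
  shows "ent (l * exp (- y)) w = ent l w - w * y"
proof (cases "w = 0")
  case False
  then have "ln (l * exp (- y) / w) = ln (l / w) - y"
    using assms by (simp add: ln_div ln_mult)
  then show ?thesis unfolding ent_def by (simp only:) (simp add: algebra_simps)
qed (simp add: ent_def)

lemma ent_mult_right:
  assumes "l > 0" "w \<ge> 0" "r > 0"
  shows "ent l (r * w) = r * (ent l w - w * ln r)"
proof (cases "w = 0")
  case False
  then have "ln (l / (r * w)) = ln (l / w) - ln r"
    using assms by (simp add: ln_div ln_mult)
  then show ?thesis unfolding ent_def by (simp only:) (simp add: algebra_simps)
qed (simp add: ent_def)

lemma continuous_on_ent:
  assumes "l > 0"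
  shows "continuous_on {0..} (ent l)"
  unfolding continuous_on_eq_continuous_within
proof
  fix x :: real assume "x \<in> {0..}"
  show "continuous (at x within {0..}) (ent l)"
  proof (cases "x = 0")
    case True
    have "((\<lambda>w. w * (1 + ln (l / w))) \<longlongrightarrow> 0) (at_right 0)"
      using assms by real_asymp
    then show ?thesis
      unfolding True continuous_within ent_def by (simp add: at_within_Ici_at_right)
  next
    case False
    with \<open>x \<in> {0..}\<close> have "x > 0" by simp
    then have "isCont (\<lambda>w. w * (1 + ln (l / w))) x"
      using assms by (intro continuous_intros) auto
    then show ?thesis
      unfolding ent_def[abs_def] by (rule continuous_at_imp_continuous_at_within)
  qed
qed

section \<open>The variational functional\<close>

text \<open>The sum runs over ordered pairs, so an edge with both ends in \<open>A \<inter> B\<close> is counted twice. This makes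
  \<open>edge_weight\<close> biadditive in the two sets, at the price of the factor \<open>1 / 2\<close> in \<open>functional\<close>.\<close>

definition edge_weight :: "'a set set \<Rightarrow> ('a \<Rightarrow> real) \<Rightarrow> 'a set \<Rightarrow> 'a set \<Rightarrow> real" where
  "edge_weight E w A B = (\<Sum>u\<in>A. \<Sum>v\<in>B. if {u, v} \<in> E then w u * w v else 0)"

definition functional ::
    "'a set set \<Rightarrow> real \<Rightarrow> ('a \<Rightarrow> real) \<Rightarrow> 'a set \<Rightarrow> ('a \<Rightarrow> real) \<Rightarrow> real" where
  "functional E K l U w = (\<Sum>v\<in>U. ent (l v) (w v)) - K / 2 * edge_weight E w U U"

lemma edge_weight_commute: "edge_weight E w A B = edge_weight E w B A"
  unfolding edge_weight_def by (subst sum.swap) (simp only: insert_commute mult.commute)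

lemma edge_weight_Un_right:
  assumes "finite B" "finite C" "B \<inter> C = {}"
  shows "edge_weight E w A (B \<union> C) = edge_weight E w A B + edge_weight E w A C"
  using assms by (simp add: edge_weight_def sum.union_disjoint sum.distrib)

lemma edge_weight_Un_left:
  assumes "finite B" "finite C" "B \<inter> C = {}"
  shows "edge_weight E w (B \<union> C) A = edge_weight E w B A + edge_weight E w C A"
  using assms by (simp add: edge_weight_def sum.union_disjoint)

lemma edge_weight_eq_0:
  assumes "\<And>u v. u \<in> A \<Longrightarrow> v \<in> B \<Longrightarrow> {u, v} \<notin> E"
  shows "edge_weight E w A B = 0"
  using assms by (simp add: edge_weight_def)

lemma edge_weight_cong:
  assumes "\<And>v. v \<in> A \<union> B \<Longrightarrow> w v = w' v"
  shows "edge_weight E w A B = edge_weight E w' A B"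
  unfolding edge_weight_def using assms by (intro sum.cong) auto

lemma edge_weight_scale: "edge_weight E (\<lambda>v. t * w v) A B = t\<^sup>2 * edge_weight E w A B"
  unfolding edge_weight_def sum_distrib_left
  by (intro sum.cong) (auto simp: power2_eq_square)

lemma edge_weight_neighborhood:
  assumes "finite B"
  shows "edge_weight E w A B = (\<Sum>u\<in>A. w u * sum w (neighborhood E u \<inter> B))"
proof -
  have "(\<Sum>v\<in>B. if {u, v} \<in> E then w u * w v else 0) = w u * sum w (neighborhood E u \<inter> B)" for u
    unfolding sum_distrib_left using assms
    by (simp add: sum.If_cases neighborhood_def insert_commute Int_commute)
  then show ?thesis by (simp add: edge_weight_def)
qed

lemma functional_cong:
  assumes "\<And>v. v \<in> U \<Longrightarrow> w v = w' v"
  shows "functional E K l U w = functional E K l U w'"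
  unfolding functional_def using assms edge_weight_cong[of U U w w'] by simp

lemma functional_Un:
  assumes "finite A" "finite B" "A \<inter> B = {}"
  shows "functional E K l (A \<union> B) w =
    functional E K l A w + functional E K l B w - K * edge_weight E w A B"
  using assms edge_weight_commute[of E w B A]
  by (simp add: functional_def edge_weight_Un_left edge_weight_Un_right sum.union_disjoint
      algebra_simps)

text \<open>Scaling \<open>l\<close> and \<open>w\<close> together turns the functional into a polynomial in \<open>t\<close>, which is continuous and
  differentiable even where some weights vanish.\<close>

lemma functional_scale:
  assumes "t \<ge> 0"
  shows "functional E K (\<lambda>v. t * l v) U (\<lambda>v. t * w v) =
    t * (\<Sum>v\<in>U. ent (l v) (w v)) - t\<^sup>2 * (K / 2 * edge_weight E w U U)"
  using assms by (simp add: functional_def ent_scale edge_weight_scale sum_distrib_left)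

section \<open>Maximisers of the functional\<close>

text \<open>The colorability assumption speaks of the neighborhoods in the whole graph \<open>E\<close>, while \<open>U\<close> and \<open>w\<close>
  belong to an induced subgraph. In this form it passes to every subset of \<open>U\<close> unchanged, as the
  induction on \<open>U\<close> requires.\<close>

locale functional_maximizer =
  fixes E :: "'a set set" and K r :: real and l :: "'a \<Rightarrow> real" and U :: "'a set"
    and w :: "'a \<Rightarrow> real"
  assumes no_loop: "{v} \<notin> E"
    and finite_U: "finite U"
    and l_pos: "v \<in> U \<Longrightarrow> l v > 0"
    and r_ge_1: "r \<ge> 1"
    and K_ge: "K \<ge> 1 + ln r"
    and colorable: "v \<in> U \<Longrightarrow> \<exists>p. set_pmf p \<subseteq> indep_sets (neighborhood E v) E \<and>
          (\<forall>u\<in>neighborhood E v. measure_pmf.prob p {I. u \<in> I} = 1 / r)"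
    and w_nonneg: "v \<in> U \<Longrightarrow> w v \<ge> 0"
    and maximal: "(\<And>v. v \<in> U \<Longrightarrow> w' v \<ge> 0) \<Longrightarrow>
          functional E K l U w' \<le> functional E K l U w"
begin

text \<open>Seen as a function of the weight at \<open>v\<close> alone, the functional is \<open>ent c\<close> plus a constant, with \<open>c\<close> the
  right-hand side below, and \<open>ent c\<close> attains its maximum only at \<open>c\<close>.\<close>

lemma stationary:
  assumes "v \<in> U"
  shows "w v = l v * exp (- (K * sum w (neighborhood E v \<inter> U)))"
proof -
  define y where "y = K * sum w (neighborhood E v \<inter> U)"
  define c where "c = l v * exp (- y)"
  define U' where "U' = U - {v}"
  have U: "U = {v} \<union> U'" using assms by (auto simp: U'_def)
  have fin: "finite U'" using finite_U by (simp add: U'_def)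
  have v: "v \<notin> neighborhood E v" using no_loop by (simp add: neighborhood_def)
  have nb: "neighborhood E v \<inter> U' = neighborhood E v \<inter> U" using v by (auto simp: U'_def)
  have split: "functional E K l U w' =
      ent (l v) (w' v) + functional E K l U' w' - K * (w' v * sum w' (neighborhood E v \<inter> U))" for w'
    unfolding nb[symmetric] using no_loop
    by (subst U, subst functional_Un)
       (use fin in \<open>auto simp: functional_def U'_def edge_weight_neighborhood v sum.remove edge_weight_eq_0\<close>)
  have lv: "l v > 0" using l_pos assms by simp
  have c0: "c > 0" using lv by (simp add: c_def)
  have "functional E K l U (w(v := c)) \<le> functional E K l U w"
    using w_nonneg c0 by (intro maximal) auto
  moreover have "functional E K l U' (w(v := c)) = functional E K l U' w"
    by (rule functional_cong) (auto simp: U'_def)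
  moreover have "sum (w(v := c)) (neighborhood E v \<inter> U) = sum w (neighborhood E v \<inter> U)"
    using v by (intro sum.cong) auto
  ultimately have "ent (l v) c - c * y \<le> ent (l v) (w v) - w v * y"
    by (simp add: split y_def algebra_simps)
  then have "ent c c \<le> ent c (w v)"
    using ent_exp[of "l v" c y] ent_exp[of "l v" "w v" y] lv c0 w_nonneg[OF assms]
    by (simp add: c_def)
  then have "ent c (w v) = c"
    using ent_le[of c "w v"] ent_eq_iff[of c c] c0 w_nonneg[OF assms] by simp
  then show ?thesis
    using ent_eq_iff[of c "w v"] c0 w_nonneg[OF assms] by (simp add: c_def y_def)
qed

lemma w_pos: "v \<in> U \<Longrightarrow> w v > 0"
  using stationary l_pos by (metis exp_gt_zero mult_pos_pos)

lemma ent_stationary: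
  assumes "v \<in> U"
  shows "ent (l v) (w v) = w v + K * (w v * sum w (neighborhood E v \<inter> U))"
proof -
  let ?y = "K * sum w (neighborhood E v \<inter> U)"
  have "ent (l v) (w v) - w v * ?y = ent (l v * exp (- ?y)) (w v)"
    using ent_exp[of "l v" "w v" ?y] l_pos w_nonneg assms by simp
  also have "\<dots> = w v"
    unfolding stationary[OF assms, symmetric] using w_pos[OF assms] by (simp add: ent_eq_iff)
  finally show ?thesis by (simp add: algebra_simps)
qed

lemma sum_ent:
  assumes "S \<subseteq> U"
  shows "(\<Sum>u\<in>S. ent (l u) (w u)) = sum w S + K * edge_weight E w S U"
  using assms finite_U
  by (subst sum.cong[OF refl ent_stationary])
     (auto simp: sum.distrib edge_weight_neighborhood sum_distrib_left)

text \<open>Compare \<open>w\<close> with the weights that are \<open>r w\<close> on a random independent set \<open>J\<close> of \<open>S\<close> and \<open>0\<close> on the rest of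
  \<open>S\<close>. Since each vertex lies in \<open>J\<close> with probability \<open>1 / r\<close>, the expected edge weight between \<open>S\<close> and its
  complement does not change; the edges inside \<open>S\<close> disappear, and the entropy drops by \<open>ln r\<close> per unit
  of weight. The gain cannot exceed the loss at a maximiser.\<close>

lemma neighborhood_edge_weight_le:
  assumes "v \<in> U"
  defines "S \<equiv> neighborhood E v \<inter> U"
  shows "K / 2 * edge_weight E w S S \<le> ln r * sum w S"
proof -
  obtain p where p: "set_pmf p \<subseteq> indep_sets (neighborhood E v) E"
      "\<And>u. u \<in> neighborhood E v \<Longrightarrow> measure_pmf.prob p {I. u \<in> I} = 1 / r"
    using colorable[OF assms(1)] by blast
  define T where "T = U - S"
  have U: "U = S \<union> T" and ST: "S \<inter> T = {}" and fin: "finite S" "finite T"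
    using finite_U by (auto simp: S_def T_def)
  \<comment> \<open>\<open>r * g u\<close> is the contribution of \<open>u\<close> to the functional of the modified weights if \<open>u \<in> J\<close>, and \<open>C\<close> is
    the contribution of \<open>S\<close> to the functional of \<open>w\<close>.\<close>
  define g where "g u = ent (l u) (w u) - w u * ln r - K * (w u * sum w (neighborhood E u \<inter> T))" for u
  define C where "C = (\<Sum>u\<in>S. g u) + sum w S * ln r - K / 2 * edge_weight E w S S"
  have C: "functional E K l S w - K * edge_weight E w S T = C"
    using fin by (simp add: C_def g_def functional_def sum_subtractf sum.distrib sum_distrib_left
        sum_distrib_right edge_weight_neighborhood)
  have main: "(\<Sum>u\<in>S. indicator {I. u \<in> I} J * (r * g u)) \<le> C" if J: "J \<in> set_pmf p" for J
  proof -
    define w' where "w' u = (if u \<in> S then (if u \<in> J then r * w u else 0) else w u)" for u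
    have "functional E K l U w' \<le> functional E K l U w"
    proof (rule maximal)
      fix u assume "u \<in> U"
      then show "w' u \<ge> 0" using w_nonneg r_ge_1 by (simp add: w'_def)
    qed
    moreover have "functional E K l T w' = functional E K l T w"
      by (rule functional_cong) (auto simp: w'_def T_def)
    ultimately have "functional E K l S w' - K * edge_weight E w' S T \<le> C"
      unfolding C[symmetric] by (simp add: U functional_Un[OF fin ST])
    moreover have "edge_weight E w' S S = 0"
    proof -
      have "J \<in> indep_sets (neighborhood E v) E" using J p by auto
      then have "{a, b} \<notin> E" if "a \<in> J" "b \<in> J" for a b
        using that by (auto simp: indep_sets_def)
      then show ?thesis
        unfolding edge_weight_def by (intro sum.neutral ballI) (auto simp: w'_def)
    qed
    moreover have "edge_weight E w' S T =
        (\<Sum>u\<in>S. indicator {I. u \<in> I} J * (r * (w u * sum w (neighborhood E u \<inter> T))))"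
    proof -
      have "sum w' (neighborhood E u \<inter> T) = sum w (neighborhood E u \<inter> T)" for u
        by (rule sum.cong) (auto simp: w'_def T_def)
      then show ?thesis
        unfolding edge_weight_neighborhood[OF fin(2)]
        by (intro sum.cong) (simp_all add: w'_def)
    qed
    moreover have "(\<Sum>u\<in>S. ent (l u) (w' u)) =
        (\<Sum>u\<in>S. indicator {I. u \<in> I} J * (r * (ent (l u) (w u) - w u * ln r)))"
    proof (rule sum.cong[OF refl])
      fix u assume "u \<in> S"
      then have "0 \<le> w u" "0 < l u" using w_nonneg l_pos by (auto simp: S_def)
      then show "ent (l u) (w' u) = indicator {I. u \<in> I} J * (r * (ent (l u) (w u) - w u * ln r))"
        using \<open>u \<in> S\<close> r_ge_1 by (auto simp: w'_def ent_mult_right) (simp add: ent_def)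
    qed
    ultimately show ?thesis
      by (simp add: functional_def g_def sum_distrib_left sum_subtractf[symmetric] algebra_simps)
  qed
  have int: "integrable (measure_pmf p) (\<lambda>J. indicator {I. u \<in> I} J * (r * g u))" for u
    by (intro integrable_mult_left integrable_real_indicator)
       (auto simp: less_top[symmetric] measure_pmf.emeasure_finite)
  have "measure_pmf.expectation p (\<lambda>J. \<Sum>u\<in>S. indicator {I. u \<in> I} J * (r * g u)) \<le> C"
    using main int
    by (intro measure_pmf.integral_le_const Bochner_Integration.integrable_sum) (auto simp: AE_measure_pmf_iff)
  also have "measure_pmf.expectation p (\<lambda>J. \<Sum>u\<in>S. indicator {I. u \<in> I} J * (r * g u)) =
      (\<Sum>u\<in>S. measure_pmf.prob p {I. u \<in> I} * (r * g u))"
    using int by (subst Bochner_Integration.integral_sum) auto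
  also have "\<dots> = (\<Sum>u\<in>S. g u)"
    using p(2) r_ge_1 by (intro sum.cong) (auto simp: S_def)
  finally show ?thesis by (simp add: C_def mult.commute)
qed

text \<open>Deleting \<open>S = N(v) \<inter> U\<close> removes the entropy of \<open>S\<close>, which by stationarity is
  \<open>w(S) + K \<Sum>u\<in>S. w u w(N(u))\<close>, and gives back the edges that meet \<open>S\<close>. The edges leaving \<open>S\<close> cancel and
  those inside \<open>S\<close> remain once, so the loss is \<open>w(S) + K e(S) \<le> (1 + ln r) w(S)\<close>. The vertex \<open>v\<close> is
  then isolated and contributes at most \<open>l v\<close>.\<close>

lemma functional_delete_closed_neighborhood:
  assumes "v \<in> U"
  shows "functional E K l U w - K * sum w (neighborhood E v \<inter> U) \<le>
    l v + functional E K l (U - insert v (neighborhood E v)) w"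
proof -
  define S where "S = neighborhood E v \<inter> U"
  define T where "T = U - insert v (neighborhood E v)"
  define T' where "T' = insert v T"
  have v: "v \<notin> neighborhood E v" using no_loop by (simp add: neighborhood_def)
  have U: "U = S \<union> T'" and ST: "S \<inter> T' = {}" and fin: "finite S" "finite T'" "finite T"
    and T': "T' = {v} \<union> T" and vT: "{v} \<inter> T = {}"
    using finite_U v assms by (auto simp: S_def T_def T'_def)
  have "edge_weight E w {v} T = 0" "edge_weight E w {v} {v} = 0"
    using no_loop by (auto intro!: edge_weight_eq_0 simp: T_def neighborhood_def insert_commute)
  then have 1: "functional E K l T' w = ent (l v) (w v) + functional E K l T w"
    using fin vT by (simp add: T' functional_Un del: insert_is_Un[symmetric] Un_insert_left) (simp add: functional_def)
  have "ent (l v) (w v) \<le> l v" using ent_le l_pos w_nonneg assms by simp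
  moreover have "functional E K l U w = functional E K l S w + functional E K l T' w
      - K * edge_weight E w S T'"
    unfolding U by (rule functional_Un) (use fin ST in auto)
  moreover have "functional E K l S w = sum w S + K * edge_weight E w S U - K / 2 * edge_weight E w S S"
    using sum_ent[of S] by (simp add: functional_def U)
  moreover have "edge_weight E w S U = edge_weight E w S S + edge_weight E w S T'"
    unfolding U by (rule edge_weight_Un_right) (use fin ST in auto)
  moreover have "K / 2 * edge_weight E w S S \<le> ln r * sum w S"
    unfolding S_def by (rule neighborhood_edge_weight_le[OF assms])
  moreover have "(1 + ln r) * sum w S \<le> K * sum w S"
    using K_ge w_nonneg by (intro mult_right_mono sum_nonneg) (auto simp: S_def)
  ultimately show ?thesis
    unfolding S_def[symmetric] T_def[symmetric] using 1 by (simp add: algebra_simps)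
qed

end

section \<open>The independence polynomial along a ray\<close>

lemma finite_indep_sets: "finite U \<Longrightarrow> finite (indep_sets U E)"
  by (rule finite_subset[of _ "Pow U"]) (auto simp: indep_sets_def)

lemma indep_poly_ge_1:
  assumes "finite U" "\<And>v. v \<in> U \<Longrightarrow> lam v \<ge> 0"
  shows "indep_poly U E lam \<ge> 1"
proof -
  have "(\<Sum>I\<in>{{}}. \<Prod>v\<in>I. lam v) \<le> (\<Sum>I\<in>indep_sets U E. \<Prod>v\<in>I. lam v)"
    using assms finite_indep_sets[OF assms(1)]
    by (intro sum_mono2) (auto simp: indep_sets_def intro!: prod_nonneg)
  then show ?thesis by (simp add: indep_poly_def)
qed

text \<open>Differentiating the factor of \<open>v\<close> in the term of an independent set \<open>I\<close> removes \<open>v\<close> from \<open>I\<close>, and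
  \<open>I \<mapsto> I - {v}\<close> is a bijection from the independent sets containing \<open>v\<close> to those of \<open>U - N[v]\<close>.\<close>

lemma has_real_derivative_indep_poly:
  fixes l :: "'a \<Rightarrow> real"
  assumes "finite U" and no_loop: "\<And>v. {v} \<notin> E"
  shows "((\<lambda>t. indep_poly U E (\<lambda>v. exp (t * l v) - 1)) has_real_derivative
    (\<Sum>v\<in>U. l v * exp (t * l v) *
       indep_poly (U - insert v (neighborhood E v)) E (\<lambda>v. exp (t * l v) - 1))) (at t)"
proof -
  let ?I = "indep_sets U E"
  define f where "f v = exp (t * l v) - 1" for v
  define f' where "f' v = l v * exp (t * l v)" for v
  have fin: "finite I" if "I \<in> ?I" for I
    using that assms(1) finite_subset by (auto simp: indep_sets_def)
  have "((\<lambda>t. indep_poly U E (\<lambda>v. exp (t * l v) - 1)) has_real_derivative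
      (\<Sum>I\<in>?I. \<Sum>v\<in>I. f' v * prod f (I - {v}))) (at t)"
    unfolding indep_poly_def f_def f'_def
    by (intro DERIV_sum has_field_derivative_prod) (auto intro!: derivative_eq_intros)
  also have "(\<Sum>I\<in>?I. \<Sum>v\<in>I. f' v * prod f (I - {v})) =
      (\<Sum>I\<in>?I. \<Sum>v | v \<in> U \<and> v \<in> I. f' v * prod f (I - {v}))"
    by (intro sum.cong) (auto simp: indep_sets_def)
  also have "\<dots> = (\<Sum>v\<in>U. \<Sum>I | I \<in> ?I \<and> v \<in> I. f' v * prod f (I - {v}))"
    using assms finite_indep_sets by (intro sum.swap_restrict) auto
  also have "\<dots> = (\<Sum>v\<in>U. f' v * indep_poly (U - insert v (neighborhood E v)) E f)"
  proof (rule sum.cong[OF refl])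
    fix v assume v: "v \<in> U"
    have "(\<Sum>I | I \<in> ?I \<and> v \<in> I. prod f (I - {v})) =
        (\<Sum>I\<in>indep_sets (U - insert v (neighborhood E v)) E. prod f I)"
      using v no_loop
      by (intro sum.reindex_bij_witness[of _ "insert v" "\<lambda>I. I - {v}"])
         (auto simp: indep_sets_def neighborhood_def insert_commute)
    then show "(\<Sum>I | I \<in> ?I \<and> v \<in> I. f' v * prod f (I - {v})) =
        f' v * indep_poly (U - insert v (neighborhood E v)) E f"
      by (simp add: indep_poly_def flip: sum_distrib_left)
  qed
  finally show ?thesis by (simp add: f_def[abs_def] f'_def)
qed

text \<open>The right-hand side is the derivative of the independence polynomial along the ray through \<open>l\<close>, and
  \<open>sum w U\<close> is the derivative of the functional along the same ray. So, given the bound for the smaller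
  graphs, the polynomial grows at least as fast as the exponential of the functional.\<close>

lemma (in functional_maximizer) derivative_ge:
  assumes "\<And>v. v \<in> U \<Longrightarrow> functional E K l (U - insert v (neighborhood E v)) w
      \<le> ln (indep_poly (U - insert v (neighborhood E v)) E (\<lambda>v. exp (l v) - 1))"
  shows "sum w U * exp (functional E K l U w) \<le>
    (\<Sum>v\<in>U. l v * exp (l v) *
       indep_poly (U - insert v (neighborhood E v)) E (\<lambda>v. exp (l v) - 1))"
  unfolding sum_distrib_right
proof (rule sum_mono)
  fix v assume v: "v \<in> U"
  let ?T = "U - insert v (neighborhood E v)"
  let ?Z = "indep_poly ?T E (\<lambda>v. exp (l v) - 1)"
  have Z: "?Z > 0"
    using indep_poly_ge_1[of ?T "\<lambda>v. exp (l v) - 1" E] finite_U l_pos by (simp add: less_imp_le)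
  have "w v * exp (functional E K l U w) =
      l v * exp (functional E K l U w - K * sum w (neighborhood E v \<inter> U))"
    by (subst stationary[OF v]) (simp add: exp_diff exp_minus field_simps)
  also have "\<dots> \<le> l v * exp (l v + ln ?Z)"
    using functional_delete_closed_neighborhood[OF v] assms[OF v] l_pos[OF v]
    by (intro mult_left_mono) auto
  also have "\<dots> = l v * exp (l v) * ?Z" using Z by (simp add: exp_add)
  finally show "w v * exp (functional E K l U w) \<le> l v * exp (l v) * ?Z" .
qed

section \<open>The minimum principle\<close>

text \<open>\<open>ent (l v)\<close> is largest at \<open>l v\<close> and edges only cost, so no weight above \<open>l v\<close> is of use. This confines the
  maximisation over all nonnegative weights to a compact box.\<close>

lemma functional_le_clip:
  assumes "finite U" "K \<ge> 0" "\<And>v. v \<in> U \<Longrightarrow> l v > 0" "\<And>v. v \<in> U \<Longrightarrow> w v \<ge> 0"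
  shows "functional E K l U w \<le> functional E K l U (\<lambda>v. min (w v) (l v))"
proof -
  have "ent (l v) (w v) \<le> ent (l v) (min (w v) (l v))" if "v \<in> U" for v
    using ent_le[of "l v" "w v"] ent_eq_iff[of "l v" "l v"] assms(3,4)[OF that]
    by (cases "w v \<le> l v") (auto simp: min_def)
  moreover have "edge_weight E (\<lambda>v. min (w v) (l v)) U U \<le> edge_weight E w U U"
    unfolding edge_weight_def using assms
    by (intro sum_mono) (auto intro!: mult_mono simp: less_imp_le)
  ultimately show ?thesis
    unfolding functional_def using assms by (intro diff_mono sum_mono mult_left_mono) auto
qed

text \<open>If the bound fails for \<open>U\<close>, the gap \<open>D t x\<close> between the two sides at \<open>t l\<close> and \<open>t x\<close> has a negative minimum
  over \<open>t \<in> [0, 1]\<close> and \<open>x\<close> in the box. It lies at some \<open>t > 0\<close> because \<open>D 0 = 0\<close>, and minimality in \<open>x\<close> makes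
  \<open>t x\<close> a maximiser. By \<open>derivative_ge\<close> and the induction hypothesis, the derivative of \<open>D\<close> in \<open>t\<close> is at
  least \<open>(w(U) / t) (exp (- D) - 1) > 0\<close>, where \<open>w = t x\<close>, so decreasing \<open>t\<close> decreases \<open>D\<close> further.\<close>

lemma ln_indep_poly_ge_functional:
  fixes l w :: "'a \<Rightarrow> real"
  assumes "finite U" and no_loop: "\<And>v. {v} \<notin> E" and r: "r \<ge> 1" "K \<ge> 1 + ln r"
    and "\<And>v. v \<in> U \<Longrightarrow> \<exists>p. set_pmf p \<subseteq> indep_sets (neighborhood E v) E \<and>
          (\<forall>u\<in>neighborhood E v. measure_pmf.prob p {I. u \<in> I} = 1 / r)"
    and "\<And>v. v \<in> U \<Longrightarrow> l v > 0" "\<And>v. v \<in> U \<Longrightarrow> w v \<ge> 0"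
  shows "functional E K l U w \<le> ln (indep_poly U E (\<lambda>v. exp (l v) - 1))"
  using assms(1,5-7)
proof (induction U arbitrary: l w rule: finite_psubset_induct)
  case (psubset U)
  note fin = \<open>finite U\<close> and col = psubset.prems(1) and l = psubset.prems(2)
  have K: "K > 0" using r ln_ge_zero[of r] by linarith
  define Z where "Z t = indep_poly U E (\<lambda>v. exp (t * l v) - 1)" for t
  define D where "D t x = ln (Z t) - functional E K (\<lambda>v. t * l v) U (\<lambda>v. t * x v)" for t x
  have Z: "Z t \<ge> 1" if "t \<ge> 0" for t
    unfolding Z_def using fin l that by (intro indep_poly_ge_1) (auto simp: less_imp_le)
  \<comment> \<open>Fixing the coordinates outside \<open>U\<close> at \<open>0\<close> makes the box compact in the product topology.\<close>
  define box where "box = (\<Pi>\<^sub>E v\<in>UNIV. if v \<in> U then {0..l v} else {0})"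
  have box: "0 \<le> x v" "x v \<le> l v" if "x \<in> box" "v \<in> U" for x v
    using that by (auto simp: box_def PiE_iff split: if_splits dest: spec[of _ v])
  show ?case
  proof (rule ccontr)
    assume "\<not> functional E K l U w \<le> ln (indep_poly U E (\<lambda>v. exp (l v) - 1))"
    then have less: "ln (Z 1) < functional E K l U (\<lambda>v. min (w v) (l v))"
      using functional_le_clip[of U K l w E] fin K l psubset.prems(3) by (simp add: Z_def)
    define x0 where "x0 v = (if v \<in> U then min (w v) (l v) else 0)" for v
    have x0: "x0 \<in> box"
      using l psubset.prems(3) by (auto simp: box_def x0_def less_imp_le)
    have "functional E K l U x0 = functional E K l U (\<lambda>v. min (w v) (l v))"
      by (rule functional_cong) (simp add: x0_def)
    with less have "D 1 x0 < 0" by (simp add: D_def)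
    have "compact box"
      unfolding compactin_euclidean_iff[symmetric] euclidean_product_topology[symmetric] box_def
        compactin_PiE by auto
    then have "compact ({0..1::real} \<times> box)" by (intro compact_Times) auto
    moreover have "continuous_on ({0..1::real} \<times> box) (\<lambda>p. D (fst p) (snd p))"
    proof -
      have x: "continuous_on ({0..1::real} \<times> box) (\<lambda>p::real \<times> ('a \<Rightarrow> real). snd p v)" for v
        by (rule continuous_on_product_then_coordinatewise) (intro continuous_intros)
      have "continuous_on ({0..1::real} \<times> box) (\<lambda>p. ent (l v) (snd p v))" if "v \<in> U" for v
        by (rule continuous_on_compose2[OF continuous_on_ent[OF l[OF that]] x]) (use box that in auto)
      moreover have "continuous_on ({0..1::real} \<times> box) (\<lambda>p. edge_weight E (snd p) U U)"
      proof -
        have "continuous_on ({0..1} \<times> box)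
            (\<lambda>p::real \<times> ('a \<Rightarrow> real). if {u, v} \<in> E then snd p u * snd p v else 0)" for u v
          by (cases "{u, v} \<in> E") (auto intro!: continuous_intros x)
        then show ?thesis unfolding edge_weight_def by (intro continuous_on_sum)
      qed
      moreover have "continuous_on ({0..1::real} \<times> box) (\<lambda>p. ln (Z (fst p)))"
      proof (rule continuous_on_ln)
        have "continuous_on UNIV Z"
          unfolding Z_def
          using has_real_derivative_indep_poly[OF fin no_loop] DERIV_isCont continuous_at_imp_continuous_on
          by blast
        then show "continuous_on ({0..1::real} \<times> box) (\<lambda>p. Z (fst p))"
          by (rule continuous_on_compose2) (auto intro!: continuous_intros)
      qed (use Z in force)
      ultimately have "continuous_on ({0..1::real} \<times> box) (\<lambda>p. ln (Z (fst p)) -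
          (fst p * (\<Sum>v\<in>U. ent (l v) (snd p v)) - (fst p)\<^sup>2 * (K / 2 * edge_weight E (snd p) U U)))"
        by (intro continuous_on_diff continuous_on_mult continuous_on_sum continuous_on_power
            continuous_on_fst continuous_on_id continuous_on_const) auto
      then show ?thesis
        by (rule continuous_on_eq) (auto simp: D_def functional_scale)
    qed
    ultimately obtain t x where tx: "t \<in> {0..1}" "x \<in> box"
      and min: "\<And>s y. s \<in> {0..1} \<Longrightarrow> y \<in> box \<Longrightarrow> D t x \<le> D s y"
      using continuous_attains_inf[of "{0..1} \<times> box" "\<lambda>p. D (fst p) (snd p)"] x0 by force
    have neg: "D t x < 0" using min[of 1 x0] x0 \<open>D 1 x0 < 0\<close> by simp
    have "D 0 x = 0"
    proof -
      have "(\<Prod>v\<in>I. 0) = (if I = {} then 1 else 0 :: real)" if "I \<in> indep_sets U E" for I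
      proof -
        have "finite I" using that fin by (auto simp: indep_sets_def intro: finite_subset)
        then show ?thesis by auto
      qed
      then have "Z 0 = (\<Sum>I\<in>indep_sets U E. if I = {} then 1 else 0)"
        unfolding Z_def indep_poly_def by (intro sum.cong) auto
      also have "\<dots> = 1"
        using fin finite_indep_sets by (subst sum.delta) (auto simp: indep_sets_def)
      finally show ?thesis using functional_scale[of 0 E K l U x] by (simp add: D_def)
    qed
    with neg tx have t: "0 < t" "t \<le> 1" by (cases "t = 0"; force)+
    let ?l = "\<lambda>v. t * l v" and ?w = "\<lambda>v. t * x v"
    interpret functional_maximizer E K r ?l U ?w
    proof unfold_locales
      fix w' :: "'a \<Rightarrow> real" assume w': "\<And>v. v \<in> U \<Longrightarrow> w' v \<ge> 0"
      define y where "y v = (if v \<in> U then min (w' v) (t * l v) / t else 0)" for v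
      have "y v \<ge> 0" "y v \<le> l v" if "v \<in> U" for v
      proof -
        have "min (w' v) (t * l v) \<le> t * l v" by simp
        then show "y v \<le> l v" using that t by (simp add: y_def divide_le_eq mult.commute)
        show "y v \<ge> 0" using that t l w' by (simp add: y_def less_imp_le)
      qed
      then have "y \<in> box" by (auto simp: box_def y_def)
      then have "D t x \<le> D t y" using min t by simp
      moreover have "functional E K ?l U (\<lambda>v. t * y v) =
          functional E K ?l U (\<lambda>v. min (w' v) (?l v))"
        using t by (intro functional_cong) (simp add: y_def)
      moreover have "functional E K ?l U w' \<le> functional E K ?l U (\<lambda>v. min (w' v) (?l v))"
        using fin K l t w' by (intro functional_le_clip) auto
      ultimately show "functional E K ?l U w' \<le> functional E K ?l U ?w"
        by (simp add: D_def)
    qed (use fin no_loop r col l t box tx in auto)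
    define Z' where "Z' = (\<Sum>v\<in>U. l v * exp (t * l v) *
       indep_poly (U - insert v (neighborhood E v)) E (\<lambda>v. exp (t * l v) - 1))"
    have Z': "(Z has_real_derivative Z') (at t)"
      unfolding Z_def Z'_def using has_real_derivative_indep_poly[OF fin no_loop] .
    define a where "a = (\<Sum>v\<in>U. ent (l v) (x v))"
    define b where "b = K / 2 * edge_weight E x U U"
    have Dx: "D s x = ln (Z s) - (s * a - s\<^sup>2 * b)" if "s \<ge> 0" for s
      using that by (simp add: D_def functional_scale a_def b_def)
    have deriv: "((\<lambda>s. ln (Z s) - (s * a - s\<^sup>2 * b)) has_real_derivative
        (Z' / Z t - (a - 2 * t * b))) (at t)"
      using Z[of t] t by (auto intro!: derivative_eq_intros Z' simp: field_simps)
    have sum_pos: "sum ?w U > 0"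
    proof -
      have "U \<noteq> {}"
      proof
        assume "U = {}"
        then have "D t x = ln (Z t)" by (simp add: D_def functional_def edge_weight_def)
        with Z[of t] t neg show False by simp
      qed
      then show ?thesis using fin w_pos by (intro sum_pos) auto
    qed
    \<comment> \<open>The derivative of the functional along the ray, multiplied by \<open>t\<close>; stationarity cancels the edges.\<close>
    have "t * (a - 2 * t * b) = sum ?w U"
    proof -
      have "t * a = (\<Sum>v\<in>U. ent (t * l v) (t * x v))"
        using t by (simp add: a_def ent_scale sum_distrib_left)
      also have "\<dots> = sum ?w U + t * (2 * t * b)"
        by (subst sum_ent) (auto simp: b_def edge_weight_scale power2_eq_square)
      finally show ?thesis by (simp add: algebra_simps)
    qed
    moreover have "sum ?w U * exp (functional E K ?l U ?w) \<le> t * Z'"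
    proof -
      have "functional E K ?l (U - insert v (neighborhood E v)) ?w
        \<le> ln (indep_poly (U - insert v (neighborhood E v)) E (\<lambda>v. exp (?l v) - 1))" if "v \<in> U" for v
        using that col l t box tx by (intro psubset.IH) auto
      from derivative_ge[OF this] show ?thesis
        by (simp add: Z'_def sum_distrib_left mult.assoc)
    qed
    moreover have "exp (functional E K ?l U ?w) > Z t"
    proof -
      have "Z t = exp (ln (Z t))" using Z[of t] t by simp
      also have "\<dots> < exp (functional E K ?l U ?w)"
        using neg by (subst exp_less_cancel_iff) (simp add: D_def)
      finally show ?thesis .
    qed
    then have "sum ?w U * Z t < sum ?w U * exp (functional E K ?l U ?w)"
      using sum_pos by simp
    ultimately have "t * (a - 2 * t * b) * Z t < t * Z'" by simp
    then have "(a - 2 * t * b) * Z t < Z'"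
      using t by (simp only: mult.assoc mult_less_cancel_left_pos)
    then have "0 < Z' / Z t - (a - 2 * t * b)"
      using t Z[of t] by (simp add: pos_less_divide_eq)
    then obtain d where d: "d > 0"
      "\<And>h. 0 < h \<Longrightarrow> h < d \<Longrightarrow> ln (Z (t - h)) - ((t - h) * a - (t - h)\<^sup>2 * b) < ln (Z t) - (t * a - t\<^sup>2 * b)"
      using DERIV_pos_inc_left[OF deriv] by blast
    define h where "h = min (d / 2) t"
    have h: "0 < h" "h < d" "h \<le> t" using d t by (auto simp: h_def)
    then have "D (t - h) x < D t x" using d(2)[of h] t by (simp add: Dx)
    moreover have "D t x \<le> D (t - h) x" using h t tx by (intro min) auto
    ultimately show False by simp
  qed
qed

section \<open>Edge sums and the Lambert function\<close>

lemma edge_weight_eq_sum_edges: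
  assumes "finite_simple_graph V E"
  shows "edge_weight E w V V = 2 * (\<Sum>e\<in>E. \<Prod>v\<in>e. w v)"
proof -
  interpret finite_simple_graph V E by fact
  define P where "P = {p \<in> V \<times> V. {fst p, snd p} \<in> E}"
  have fin: "finite P" "finite E"
    using finite_vertices edges finite_subset[of E "Pow V"] by (auto simp: P_def)
  have "edge_weight E w V V = (\<Sum>p\<in>V \<times> V. if {fst p, snd p} \<in> E then w (fst p) * w (snd p) else 0)"
    by (simp add: edge_weight_def sum.cartesian_product case_prod_beta)
  also have "\<dots> = (\<Sum>p\<in>P. w (fst p) * w (snd p))"
    unfolding P_def using finite_vertices by (simp add: sum.inter_filter)
  also have "\<dots> = (\<Sum>e\<in>E. \<Sum>p | p \<in> P \<and> {fst p, snd p} = e. w (fst p) * w (snd p))"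
    using fin by (intro sum.group[symmetric]) (auto simp: P_def)
  also have "\<dots> = (\<Sum>e\<in>E. 2 * (\<Prod>v\<in>e. w v))"
  proof (rule sum.cong[OF refl])
    fix e assume e: "e \<in> E"
    then obtain a b where ab: "e = {a, b}" "a \<noteq> b" using edges[OF e] by (auto simp: card_2_iff)
    have "{p. p \<in> P \<and> {fst p, snd p} = e} = {(a, b), (b, a)}"
      using e edges[OF e] by (auto simp: ab P_def doubleton_eq_iff insert_commute)
    then show "(\<Sum>p | p \<in> P \<and> {fst p, snd p} = e. w (fst p) * w (snd p)) = 2 * (\<Prod>v\<in>e. w v)"
      using ab by simp
  qed
  finally show ?thesis by (simp add: sum_distrib_left)
qed

lemma edge_weight_le_degree:
  assumes "finite V" "\<And>e. e \<in> E \<Longrightarrow> e \<subseteq> V"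
  shows "edge_weight E w V V \<le> (\<Sum>v\<in>V. real (vertex_degree E v) * (w v)\<^sup>2)"
proof -
  have amgm: "a * b \<le> a\<^sup>2 / 2 + b\<^sup>2 / 2" for a b :: real
    using sum_squares_bound[of a b] by simp
  have nb: "neighborhood E v \<inter> V = neighborhood E v" for v
    using assms(2) by (auto simp: neighborhood_def)
  have deg: "(\<Sum>u\<in>V. \<Sum>v\<in>V. if {u, v} \<in> E then (w u)\<^sup>2 / 2 else 0) =
      (\<Sum>v\<in>V. real (vertex_degree E v) * (w v)\<^sup>2) / 2"
  proof -
    have "(\<Sum>v\<in>V. if {u, v} \<in> E then (w u)\<^sup>2 / 2 else 0) = real (vertex_degree E u) * (w u)\<^sup>2 / 2" for u
    proof -
      have "V \<inter> {v. {u, v} \<in> E} = neighborhood E u"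
        using nb[of u] by (auto simp: neighborhood_def insert_commute)
      then show ?thesis using assms(1) by (simp add: sum.If_cases vertex_degree_def)
    qed
    then show ?thesis by (simp only: sum_divide_distrib)
  qed
  have "edge_weight E w V V \<le>
      (\<Sum>u\<in>V. \<Sum>v\<in>V. (if {u, v} \<in> E then (w u)\<^sup>2 / 2 else 0) + (if {v, u} \<in> E then (w v)\<^sup>2 / 2 else 0))"
    unfolding edge_weight_def by (intro sum_mono) (auto simp: insert_commute amgm)
  also have "\<dots> = (\<Sum>u\<in>V. \<Sum>v\<in>V. if {u, v} \<in> E then (w u)\<^sup>2 / 2 else 0) +
      (\<Sum>u\<in>V. \<Sum>v\<in>V. if {v, u} \<in> E then (w v)\<^sup>2 / 2 else 0)"
    by (simp add: sum.distrib)
  also have "(\<Sum>u\<in>V. \<Sum>v\<in>V. if {v, u} \<in> E then (w v)\<^sup>2 / 2 else 0) =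
      (\<Sum>u\<in>V. \<Sum>v\<in>V. if {u, v} \<in> E then (w u)\<^sup>2 / 2 else 0)"
    by (rule sum.swap)
  finally show ?thesis by (simp add: deg)
qed

lemma Lambert_W:
  assumes "z \<ge> 0"
  shows "Lambert_W z \<ge> 0" "Lambert_W z * exp (Lambert_W z) = z"
  using theI'[OF Lambert_W_ex1[OF assms]] by (simp_all add: Lambert_W_def)

text \<open>Splitting each product on an edge by the inequality of the means leaves one problem per
  vertex, to maximise \<open>ent l w - c w\<^sup>2 / 2\<close> with \<open>c = K d(v)\<close>. The critical point satisfies \<open>ln (l / w) = c w\<close>,
  that is, \<open>c w exp (c w) = c l\<close>.\<close>

lemma ent_Lambert_W:
  assumes "c > 0" "l > 0"
  defines "w \<equiv> Lambert_W (c * l) / c"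
  shows "w > 0" "ent l w - c * w\<^sup>2 / 2 = A_fun (Lambert_W (c * l)) / c"
proof -
  define W where "W = Lambert_W (c * l)"
  have W: "W \<ge> 0" "W * exp W = c * l" using Lambert_W[of "c * l"] assms by (auto simp: W_def)
  then have "W \<noteq> 0" using assms by auto
  then show "w > 0" using W assms by (simp add: w_def W_def)
  have "l / w = c * l / W" by (simp add: w_def flip: W_def)
  also have "\<dots> = exp W" unfolding W(2)[symmetric] using \<open>W \<noteq> 0\<close> by simp
  finally have "l / w = exp W" .
  then show "ent l w - c * w\<^sup>2 / 2 = A_fun (Lambert_W (c * l)) / c"
    using assms(1) by (simp add: ent_def A_fun_def w_def power2_eq_square field_simps flip: W_def)
qed

section \<open>The bounds for the given fugacities\<close>

theorem theorem19:
  fixes r :: real and V :: "'a set" and E :: "'a set set" and lam :: "'a \<Rightarrow> real"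
  assumes "r \<ge> 1"
    and "finite_simple_graph V E"
    and "fractionally_colorable_neighborhoods r V E"
    and "\<And>v. v \<in> V \<Longrightarrow> lam v > 0"
  shows "ereal (ln (indep_poly V E lam)) \<ge>
           (SUP w\<in>{w :: 'a \<Rightarrow> real. \<forall>v\<in>V. w v > 0}.
              ereal ((\<Sum>v\<in>V. w v * (1 + ln (ln (1 + lam v) / w v)))
                       - K_const r * (\<Sum>e\<in>E. \<Prod>v\<in>e. w v)))
       \<and> ln (indep_poly V E lam) \<ge>
           (\<Sum>v\<in>V. if vertex_degree E v = 0 then ln (1 + lam v)
                   else A_fun (Lambert_W (K_const r * real (vertex_degree E v) * ln (1 + lam v)))
                          / (K_const r * real (vertex_degree E v)))"
proof -
  interpret finite_simple_graph V E by fact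
  define K where "K = K_const r"
  define l where "l v = ln (1 + lam v)" for v
  have K1: "K \<ge> 1" and K: "K - 1 = ln (r * K)"
    using theI'[OF K_const_ex1[OF assms(1)]] by (simp_all add: K_def K_const_def)
  have "K \<ge> 1 + ln r"
  proof -
    have "ln (r * K) = ln r + ln K" using K1 assms(1) by (simp add: ln_mult)
    then show ?thesis using K ln_ge_zero[OF K1] by linarith
  qed
  moreover have no_loop: "{v} \<notin> E" for v using edges[of "{v}"] by auto
  moreover have "\<exists>p. set_pmf p \<subseteq> indep_sets (neighborhood E v) E \<and>
      (\<forall>u\<in>neighborhood E v. measure_pmf.prob p {I. u \<in> I} = 1 / r)" if "v \<in> V" for v
  proof -
    have "indep_sets X (induced_edges E X) = indep_sets X E" for X :: "'a set"
      by (auto simp: indep_sets_def induced_edges_def)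
    then show ?thesis
      using assms(3) that by (simp add: fractionally_colorable_neighborhoods_def)
  qed
  moreover have l: "l v > 0" if "v \<in> V" for v using assms(4)[OF that] by (simp add: l_def)
  moreover have "indep_poly V E (\<lambda>v. exp (l v) - 1) = indep_poly V E lam"
    unfolding indep_poly_def l_def using assms(4)
    by (intro sum.cong prod.cong) (auto simp: indep_sets_def exp_ln add_pos_pos subset_iff)
  ultimately have main: "functional E K l V w \<le> ln (indep_poly V E lam)"
    if "\<And>v. v \<in> V \<Longrightarrow> w v \<ge> 0" for w
    using ln_indep_poly_ge_functional[of V E r K l w] finite_vertices assms(1) that by simp
  show ?thesis
  proof
    have "functional E K l V w =
        (\<Sum>v\<in>V. w v * (1 + ln (ln (1 + lam v) / w v))) - K_const r * (\<Sum>e\<in>E. \<Prod>v\<in>e. w v)" for w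
      by (simp add: functional_def ent_def l_def K_def edge_weight_eq_sum_edges[OF assms(2)])
    then show "ereal (ln (indep_poly V E lam)) \<ge>
           (SUP w\<in>{w :: 'a \<Rightarrow> real. \<forall>v\<in>V. w v > 0}.
              ereal ((\<Sum>v\<in>V. w v * (1 + ln (ln (1 + lam v) / w v)))
                       - K_const r * (\<Sum>e\<in>E. \<Prod>v\<in>e. w v)))"
      using main by (intro SUP_least) (auto simp: less_imp_le)
  next
    define d where "d v = real (vertex_degree E v)" for v
    define w where "w v = (if d v = 0 then l v else Lambert_W (K * d v * l v) / (K * d v))" for v
    have c: "K * d v > 0" if "d v \<noteq> 0" for v
      using that K1 by (simp add: d_def)
    have "ent (l v) (l v) = l v" if "v \<in> V" for v
      using l[OF that] by (simp add: ent_eq_iff)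
    then have "(\<Sum>v\<in>V. if d v = 0 then l v else A_fun (Lambert_W (K * d v * l v)) / (K * d v)) =
        (\<Sum>v\<in>V. ent (l v) (w v) - K * d v * (w v)\<^sup>2 / 2)"
      using ent_Lambert_W(2)[OF c l] by (intro sum.cong) (auto simp: w_def)
    also have "\<dots> = (\<Sum>v\<in>V. ent (l v) (w v)) - K / 2 * (\<Sum>v\<in>V. d v * (w v)\<^sup>2)"
      by (simp add: sum_subtractf sum_distrib_left mult.assoc)
    also have "\<dots> \<le> functional E K l V w"
      unfolding functional_def d_def using K1 edges finite_vertices
      by (intro diff_left_mono mult_left_mono edge_weight_le_degree) auto
    also have "\<dots> \<le> ln (indep_poly V E lam)"
      using l ent_Lambert_W(1)[OF c l] by (intro main) (auto simp: w_def less_imp_le)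
    finally show "ln (indep_poly V E lam) \<ge>
           (\<Sum>v\<in>V. if vertex_degree E v = 0 then ln (1 + lam v)
                   else A_fun (Lambert_W (K_const r * real (vertex_degree E v) * ln (1 + lam v)))
                          / (K_const r * real (vertex_degree E v)))"
      unfolding d_def l_def K_def of_nat_eq_0_iff .
  qed
qed

end
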